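(* Let $f$ be a mean-zero skew-symmetric Gaussian field over $\mathbb{R}^D\times\mathbb{R}^D$ whose covariance function $k_f$ is in $C^4\big((\mathbb{R}^D\times\mathbb{R}^D)\times(\mathbb{R}^D\times\mathbb{R}^D)\big)$, and let $\tilde f$ be its second-order Taylor approximation at $z=(z^*,z^* )$. Then the error process $\mathcal{E}(x)=\tilde f(x)-f(x)$, $x\in\mathbb{R}^D\times\mathbb{R}^D$, is a Gaussian field over $\mathbb{R}^D\times\mathbb{R}^D$ with mean zero.
   Context: Let $D\ge 1$ and write points of $\mathbb{R}^D\times\mathbb{R}^D$ as $x=(x^{(1)},x^{(2)})$, with $x^{flip}=(x^{(2)},x^{(1)})$. A real-valued random field with finite second moments is Gaussian if every finite linear combination of its values is a (possibly degenerate) Gaussian random variable. A Gaussian field $f$ is skew-symmetric if, with probability one, $f(x^{flip})=-f(x)$ for all $x$. Derivatives of $f$ are taken in the mean-square ($L^2(\Omega)$) sense. Fix $z^*\in\mathbb{R}^D$ and $z=(z^*,z^* )$. Define $$g_i=\partial_{x^{(1)}_i}f(x)\big|_{x=z},\quad H^{(1,1)}_{i,j}=\partial_{x^{(1)}_i}\partial_{x^{(1)}_j}f(x)\big|_{x=z},\quad H^{(1,2)}_{i,j}=\partial_{x^{(1)}_i}\partial_{x^{(2)}_j}f(x)\big|_{x=z}.$$ The second-order (skew-symmetric) Taylor approximation of $f$ at $z$ is $$\tilde f(x)=g^{\mathsf T}(v-w)+\tfrac12\big(v^{\mathsf T}H^{(1,1)}v-w^{\mathsf T}H^{(1,1)}w\big)+v^{\mathsf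 T}H^{(1,2)}w,\qquad v=x^{(1)}-z^*,\ w=x^{(2)}-z^*.$$ *)

theory Defs
  imports "HOL-Probability.Probability"
begin

section \<open>Functions of class $C^n$\<close>

text \<open>On a finite-dimensional space this is equivalent to all partial derivatives of order at most
  \<open>n\<close> existing and being continuous.\<close>

primrec C_class :: "nat \<Rightarrow> ('v::euclidean_space \<Rightarrow> real) \<Rightarrow> bool" where
  "C_class 0 k \<longleftrightarrow> continuous_on UNIV k"
| "C_class (Suc n) k \<longleftrightarrow>
     (\<forall>p. k differentiable at p) \<and> (\<forall>v. C_class n (\<lambda>p. frechet_derivative k (at p) v))"


section \<open>Random fields\<close>

text \<open>A random field with index type \<open>'x\<close> on a probability space \<open>M\<close> is a function
  \<open>f :: 'x \<Rightarrow> 'w \<Rightarrow> real\<close>.\<close>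

definition square_integrable :: "'w measure \<Rightarrow> ('w \<Rightarrow> real) \<Rightarrow> bool" where
  "square_integrable M X \<longleftrightarrow> X \<in> borel_measurable M \<and> integrable M (\<lambda>\<omega>. (X \<omega>)\<^sup>2)"

text \<open>The second disjunct is the degenerate case of variance zero.\<close>

definition gaussian_rv :: "'w measure \<Rightarrow> ('w \<Rightarrow> real) \<Rightarrow> bool" where
  "gaussian_rv M X \<longleftrightarrow> X \<in> borel_measurable M \<and>
     ((\<exists>\<mu> \<sigma>. \<sigma> > 0 \<and> distributed M lborel X (normal_density \<mu> \<sigma>)) \<or>
      (\<exists>\<mu>. AE \<omega> in M. X \<omega> = \<mu>))"

definition gaussian_field :: "'w measure \<Rightarrow> ('x \<Rightarrow> 'w \<Rightarrow> real) \<Rightarrow> bool" where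
  "gaussian_field M f \<longleftrightarrow>
     (\<forall>x. square_integrable M (f x)) \<and>
     (\<forall>S c. finite S \<longrightarrow> gaussian_rv M (\<lambda>\<omega>. \<Sum>x\<in>S. c x * f x \<omega>))"

definition mean_zero :: "'w measure \<Rightarrow> ('x \<Rightarrow> 'w \<Rightarrow> real) \<Rightarrow> bool" where
  "mean_zero M f \<longleftrightarrow> (\<forall>x. integral\<^sup>L M (f x) = 0)"

definition covariance_fun :: "'w measure \<Rightarrow> ('x \<Rightarrow> 'w \<Rightarrow> real) \<Rightarrow> 'x \<times> 'x \<Rightarrow> real" where
  "covariance_fun M f = (\<lambda>(x, y).
     \<integral>\<omega>. (f x \<omega> - integral\<^sup>L M (f x)) * (f y \<omega> - integral\<^sup>L M (f y)) \<partial>M)"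

text \<open>The flip of a point \<open>x = (x\<^sup>1, x\<^sup>2)\<close> is \<^const>\<open>prod.swap\<close>.\<close>

definition skew_symmetric :: "'w measure \<Rightarrow> ('x \<times> 'x \<Rightarrow> 'w \<Rightarrow> real) \<Rightarrow> bool" where
  "skew_symmetric M f \<longleftrightarrow> (AE \<omega> in M. \<forall>x. f (prod.swap x) \<omega> = - f x \<omega>)"


section \<open>Mean-square derivatives\<close>

text \<open>Requiring square integrability of all the variables involved ensures that the integral below
  is not the default value of a non-integrable function.\<close>

definition ms_tendsto :: "'w measure \<Rightarrow> ('i \<Rightarrow> 'w \<Rightarrow> real) \<Rightarrow> ('w \<Rightarrow> real) \<Rightarrow> 'i filter \<Rightarrow> bool" where
  "ms_tendsto M X Y F \<longleftrightarrow>
     square_integrable M Y \<and> (\<forall>\<^sub>F h in F. square_integrable M (X h)) \<and>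
     ((\<lambda>h. \<integral>\<omega>. (X h \<omega> - Y \<omega>)\<^sup>2 \<partial>M) \<longlongrightarrow> 0) F"

text \<open>Mean-square derivatives are determined only up to almost sure equality, so they are
  expressed as relations: \<open>Y\<close> is a version of the derivative of \<open>f\<close> at \<open>x\<close> in direction \<open>b\<close>.\<close>

definition has_ms_deriv ::
  "'w measure \<Rightarrow> ('x::real_normed_vector \<Rightarrow> 'w \<Rightarrow> real) \<Rightarrow> 'x \<Rightarrow> 'x \<Rightarrow> ('w \<Rightarrow> real) \<Rightarrow> bool" where
  "has_ms_deriv M f b x Y \<longleftrightarrow>
     ms_tendsto M (\<lambda>h \<omega>. (f (x + h *\<^sub>R b) \<omega> - f x \<omega>) / h) Y (at 0)"

text \<open>\<open>Y\<close> is a version of the iterated derivative of \<open>f\<close> at \<open>x\<close>, first in direction \<open>b\<close>, then in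
  direction \<open>a\<close>.\<close>

definition has_ms_deriv2 ::
  "'w measure \<Rightarrow> ('x::real_normed_vector \<Rightarrow> 'w \<Rightarrow> real) \<Rightarrow> 'x \<Rightarrow> 'x \<Rightarrow> 'x \<Rightarrow> ('w \<Rightarrow> real) \<Rightarrow> bool" where
  "has_ms_deriv2 M f a b x Y \<longleftrightarrow>
     (\<exists>f'. (\<forall>\<^sub>F y in nhds x. has_ms_deriv M f b y (f' y)) \<and> has_ms_deriv M f' a x Y)"


section \<open>The skew-symmetric second-order Taylor approximation\<close>

definition dir1 :: "'n::finite \<Rightarrow> (real^'n) \<times> (real^'n)" where
  "dir1 i = (axis i 1, 0)"

definition dir2 :: "'n::finite \<Rightarrow> (real^'n) \<times> (real^'n)" where
  "dir2 j = (0, axis j 1)"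

definition taylor_coeffs ::
  "'w measure \<Rightarrow> ((real^'n) \<times> (real^'n) \<Rightarrow> 'w \<Rightarrow> real) \<Rightarrow> real^'n::finite \<Rightarrow>
   ('w \<Rightarrow> real^'n) \<Rightarrow> ('w \<Rightarrow> real^'n^'n) \<Rightarrow> ('w \<Rightarrow> real^'n^'n) \<Rightarrow> bool" where
  "taylor_coeffs M f zs g H11 H12 \<longleftrightarrow>
     (\<forall>i. has_ms_deriv M f (dir1 i) (zs, zs) (\<lambda>\<omega>. g \<omega> $ i)) \<and>
     (\<forall>i j. has_ms_deriv2 M f (dir1 i) (dir1 j) (zs, zs) (\<lambda>\<omega>. H11 \<omega> $ i $ j)) \<and>
     (\<forall>i j. has_ms_deriv2 M f (dir1 i) (dir2 j) (zs, zs) (\<lambda>\<omega>. H12 \<omega> $ i $ j))"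

definition taylor_approx ::
  "real^'n::finite \<Rightarrow> ('w \<Rightarrow> real^'n) \<Rightarrow> ('w \<Rightarrow> real^'n^'n) \<Rightarrow> ('w \<Rightarrow> real^'n^'n) \<Rightarrow>
   (real^'n) \<times> (real^'n) \<Rightarrow> 'w \<Rightarrow> real" where
  "taylor_approx zs g H11 H12 = (\<lambda>(x1, x2) \<omega>.
     let v = x1 - zs; w = x2 - zs in
       g \<omega> \<bullet> (v - w) + 1/2 * (v \<bullet> (H11 \<omega> *v v) - w \<bullet> (H11 \<omega> *v w)) + v \<bullet> (H12 \<omega> *v w))"

end

theory Submission
  imports Defs
begin

text \<open>
  Two facts carry the proof.

  A field whose covariance function \<open>k\<close> is of class \<open>C\<^sup>2\<close> has a mean-square derivative in every
  direction \<open>b\<close> at every point. The inner product in \<open>L\<^sup>2\<close> of two difference quotients of the field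
  is a second difference quotient of \<open>k\<close>, and by the mean value theorem this converges to the mixed
  derivative of \<open>k\<close>, once along \<open>b\<close> in each argument. A family in \<open>L\<^sup>2\<close> whose inner products converge is
  Cauchy, so the quotients converge because \<open>L\<^sup>2\<close> is complete (\<open>ms_derivative_exists\<close>). The derivative
  is again a field, with the mixed derivative of \<open>k\<close> as its second moments, so that one step costs two
  orders of smoothness; class \<open>C\<^sup>4\<close> pays for the two steps that the Hessian needs.

  The closed linear span in \<open>L\<^sup>2\<close> of the values of a mean-zero Gaussian field consists of centred Gaussian
  variables (\<open>ms_span_centred_gaussian\<close>). A square-integrable variable is centred Gaussian exactly when
  its characteristic function is \<open>exp (- t\<^sup>2 \<sigma>\<^sup>2 / 2)\<close> with \<open>\<sigma>\<^sup>2\<close> its second moment, and both sides of this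
  identity pass to mean-square limits. Mean-square derivatives are limits of linear combinations, so the
  entries of \<open>g\<close>, \<open>H11\<close> and \<open>H12\<close> lie in this span, in whichever versions they are given. At each point
  the error is a linear combination of these entries and a value of the field. Hence every linear
  combination of values of the error lies in the span as well.
\<close>

section \<open>The space of square-integrable random variables\<close>

context prob_space
begin

lemma square_integrable_mult_integrable:
  assumes "square_integrable M X" "square_integrable M Y"
  shows "integrable M (\<lambda>\<omega>. X \<omega> * Y \<omega>)"
proof (rule Bochner_Integration.integrable_bound)
  show "integrable M (\<lambda>\<omega>. (X \<omega>)\<^sup>2 + (Y \<omega>)\<^sup>2)"
    using assms by (auto simp: square_integrable_def)
  show "(\<lambda>\<omega>. X \<omega> * Y \<omega>) \<in> borel_measurable M"
    using assms by (auto simp: square_integrable_def)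
  have "\<bar>x * y\<bar> \<le> x\<^sup>2 + y\<^sup>2" for x y :: real
    using sum_squares_bound[of x y] sum_squares_bound[of x "-y"] zero_le_power2[of x] zero_le_power2[of y]
    by (auto simp: abs_if)
  then show "AE \<omega> in M. norm (X \<omega> * Y \<omega>) \<le> norm ((X \<omega>)\<^sup>2 + (Y \<omega>)\<^sup>2)"
    by auto
qed

lemma square_integrable_const: "square_integrable M (\<lambda>\<omega>. c)"
  by (simp add: square_integrable_def)

lemma square_integrable_integrable:
  "square_integrable M X \<Longrightarrow> integrable M X"
  using square_integrable_mult_integrable[OF _ square_integrable_const[of 1]] by simp

lemma square_integrable_lincomb:
  assumes "square_integrable M X" "square_integrable M Y"
  shows "square_integrable M (\<lambda>\<omega>. a * X \<omega> + b * Y \<omega>)"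
proof -
  have "(a * X \<omega> + b * Y \<omega>)\<^sup>2 = a\<^sup>2 * (X \<omega>)\<^sup>2 + b\<^sup>2 * (Y \<omega>)\<^sup>2 + 2 * a * b * (X \<omega> * Y \<omega>)" for \<omega>
    by (simp add: power2_eq_square algebra_simps)
  with assms square_integrable_mult_integrable[OF assms] show ?thesis
    by (auto simp: square_integrable_def)
qed

lemma square_integrable_diff:
  assumes "square_integrable M X" "square_integrable M Y"
  shows "square_integrable M (\<lambda>\<omega>. X \<omega> - Y \<omega>)"
  using square_integrable_lincomb[OF assms, of 1 "-1"] by simp

lemma square_integrable_diff_square:
  assumes "square_integrable M X" "square_integrable M Y"
  shows "integrable M (\<lambda>\<omega>. (X \<omega> - Y \<omega>)\<^sup>2)"
  using square_integrable_diff[OF assms] by (simp add: square_integrable_def)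

lemma expectation_diff_square:
  assumes "square_integrable M X" "square_integrable M Y"
  shows "expectation (\<lambda>\<omega>. (X \<omega> - Y \<omega>)\<^sup>2) =
    expectation (\<lambda>\<omega>. X \<omega> * X \<omega>) - 2 * expectation (\<lambda>\<omega>. X \<omega> * Y \<omega>) + expectation (\<lambda>\<omega>. Y \<omega> * Y \<omega>)"
proof -
  have "expectation (\<lambda>\<omega>. (X \<omega> - Y \<omega>)\<^sup>2) =
      expectation (\<lambda>\<omega>. X \<omega> * X \<omega> - 2 * (X \<omega> * Y \<omega>) + Y \<omega> * Y \<omega>)"
    by (simp add: power2_eq_square algebra_simps)
  with assms show ?thesis
    by (simp add: square_integrable_mult_integrable)
qed

lemma expectation_diff_square_triangle:
  assumes "square_integrable M X" "square_integrable M Y" "square_integrable M Z"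
  shows "expectation (\<lambda>\<omega>. (X \<omega> - Z \<omega>)\<^sup>2) \<le>
    2 * expectation (\<lambda>\<omega>. (X \<omega> - Y \<omega>)\<^sup>2) + 2 * expectation (\<lambda>\<omega>. (Y \<omega> - Z \<omega>)\<^sup>2)"
proof -
  have "expectation (\<lambda>\<omega>. (X \<omega> - Z \<omega>)\<^sup>2) \<le>
      expectation (\<lambda>\<omega>. 2 * (X \<omega> - Y \<omega>)\<^sup>2 + 2 * (Y \<omega> - Z \<omega>)\<^sup>2)"
  proof (rule integral_mono)
    fix \<omega>
    have "0 \<le> ((X \<omega> - Y \<omega>) - (Y \<omega> - Z \<omega>))\<^sup>2" by simp
    then show "(X \<omega> - Z \<omega>)\<^sup>2 \<le> 2 * (X \<omega> - Y \<omega>)\<^sup>2 + 2 * (Y \<omega> - Z \<omega>)\<^sup>2"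
      by (simp add: power2_eq_square algebra_simps)
  qed (use assms in \<open>auto simp: square_integrable_diff_square\<close>)
  with assms show ?thesis
    by (simp add: square_integrable_diff_square)
qed

lemma expectation_Cauchy_Schwarz:
  assumes "square_integrable M X" "square_integrable M Y"
  shows "expectation (\<lambda>\<omega>. \<bar>X \<omega> * Y \<omega>\<bar>) \<le>
    sqrt (expectation (\<lambda>\<omega>. (X \<omega>)\<^sup>2)) * sqrt (expectation (\<lambda>\<omega>. (Y \<omega>)\<^sup>2))"
proof -
  have [measurable]: "X \<in> borel_measurable M" "Y \<in> borel_measurable M"
    and sq: "integrable M (\<lambda>\<omega>. (X \<omega>)\<^sup>2)" "integrable M (\<lambda>\<omega>. (Y \<omega>)\<^sup>2)"
    using assms by (auto simp: square_integrable_def)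
  have XY: "integrable M (\<lambda>\<omega>. \<bar>X \<omega> * Y \<omega>\<bar>)"
    using square_integrable_mult_integrable[OF assms] by simp
  have "(\<integral>\<^sup>+\<omega>. ennreal \<bar>X \<omega>\<bar> * ennreal \<bar>Y \<omega>\<bar> \<partial>M)\<^sup>2 \<le>
      (\<integral>\<^sup>+\<omega>. (ennreal \<bar>X \<omega>\<bar>)\<^sup>2 \<partial>M) * (\<integral>\<^sup>+\<omega>. (ennreal \<bar>Y \<omega>\<bar>)\<^sup>2 \<partial>M)"
    by (rule Cauchy_Schwarz_nn_integral) auto
  also have "(\<integral>\<^sup>+\<omega>. (ennreal \<bar>X \<omega>\<bar>)\<^sup>2 \<partial>M) = ennreal (expectation (\<lambda>\<omega>. (X \<omega>)\<^sup>2))"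
    using sq by (simp add: ennreal_power nn_integral_eq_integral)
  also have "(\<integral>\<^sup>+\<omega>. (ennreal \<bar>Y \<omega>\<bar>)\<^sup>2 \<partial>M) = ennreal (expectation (\<lambda>\<omega>. (Y \<omega>)\<^sup>2))"
    using sq by (simp add: ennreal_power nn_integral_eq_integral)
  also have "(\<integral>\<^sup>+\<omega>. ennreal \<bar>X \<omega>\<bar> * ennreal \<bar>Y \<omega>\<bar> \<partial>M) = ennreal (expectation (\<lambda>\<omega>. \<bar>X \<omega> * Y \<omega>\<bar>))"
    using XY by (simp add: nn_integral_eq_integral abs_mult flip: ennreal_mult)
  finally have "(expectation (\<lambda>\<omega>. \<bar>X \<omega> * Y \<omega>\<bar>))\<^sup>2 \<le>
      expectation (\<lambda>\<omega>. (X \<omega>)\<^sup>2) * expectation (\<lambda>\<omega>. (Y \<omega>)\<^sup>2)"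
    by (simp add: ennreal_power integral_nonneg_AE flip: ennreal_mult)
  then show ?thesis
    by (metis real_sqrt_mult real_le_rsqrt)
qed

section \<open>Mean-square convergence\<close>

lemma ms_tendsto_lincomb:
  assumes "ms_tendsto M X X' F" "ms_tendsto M Y Y' F"
  shows "ms_tendsto M (\<lambda>h \<omega>. a * X h \<omega> + b * Y h \<omega>) (\<lambda>\<omega>. a * X' \<omega> + b * Y' \<omega>) F"
proof -
  let ?dX = "\<lambda>h. expectation (\<lambda>\<omega>. (X h \<omega> - X' \<omega>)\<^sup>2)"
  let ?dY = "\<lambda>h. expectation (\<lambda>\<omega>. (Y h \<omega> - Y' \<omega>)\<^sup>2)"
  have sq: "square_integrable M X'" "square_integrable M Y'"
    and ev: "\<forall>\<^sub>F h in F. square_integrable M (X h) \<and> square_integrable M (Y h)"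
    and lim: "(?dX \<longlongrightarrow> 0) F" "(?dY \<longlongrightarrow> 0) F"
    using assms by (auto simp: ms_tendsto_def eventually_conj_iff)
  have bound: "((\<lambda>h. 2 * a\<^sup>2 * ?dX h + 2 * b\<^sup>2 * ?dY h) \<longlongrightarrow> 2 * a\<^sup>2 * 0 + 2 * b\<^sup>2 * 0) F"
    by (intro tendsto_intros lim)
  have "((\<lambda>h. expectation (\<lambda>\<omega>. ((a * X h \<omega> + b * Y h \<omega>) - (a * X' \<omega> + b * Y' \<omega>))\<^sup>2)) \<longlongrightarrow> 0) F"
  proof (rule Lim_null_comparison)
    show "\<forall>\<^sub>F h in F. norm (expectation (\<lambda>\<omega>. ((a * X h \<omega> + b * Y h \<omega>) - (a * X' \<omega> + b * Y' \<omega>))\<^sup>2))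
        \<le> 2 * a\<^sup>2 * ?dX h + 2 * b\<^sup>2 * ?dY h"
      using ev
    proof eventually_elim
      case (elim h)
      note d = elim sq
      have "expectation (\<lambda>\<omega>. ((a * X h \<omega> + b * Y h \<omega>) - (a * X' \<omega> + b * Y' \<omega>))\<^sup>2)
          \<le> expectation (\<lambda>\<omega>. 2 * a\<^sup>2 * (X h \<omega> - X' \<omega>)\<^sup>2 + 2 * b\<^sup>2 * (Y h \<omega> - Y' \<omega>)\<^sup>2)"
      proof (rule integral_mono)
        show "integrable M (\<lambda>\<omega>. ((a * X h \<omega> + b * Y h \<omega>) - (a * X' \<omega> + b * Y' \<omega>))\<^sup>2)"
          using d by (intro square_integrable_diff_square square_integrable_lincomb) auto
        fix \<omega>
        have "0 \<le> (a * (X h \<omega> - X' \<omega>) - b * (Y h \<omega> - Y' \<omega>))\<^sup>2" by simp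
        then show "((a * X h \<omega> + b * Y h \<omega>) - (a * X' \<omega> + b * Y' \<omega>))\<^sup>2
            \<le> 2 * a\<^sup>2 * (X h \<omega> - X' \<omega>)\<^sup>2 + 2 * b\<^sup>2 * (Y h \<omega> - Y' \<omega>)\<^sup>2"
          by (simp add: power2_eq_square algebra_simps)
      qed (use d in \<open>auto simp: square_integrable_diff_square\<close>)
      also have "\<dots> = 2 * a\<^sup>2 * ?dX h + 2 * b\<^sup>2 * ?dY h"
        using d by (simp add: square_integrable_diff_square)
      finally show ?case by (simp add: integral_nonneg_AE)
    qed
  qed (use bound in simp)
  moreover have "\<forall>\<^sub>F h in F. square_integrable M (\<lambda>\<omega>. a * X h \<omega> + b * Y h \<omega>)"
    using ev by eventually_elim (auto intro: square_integrable_lincomb)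
  ultimately show ?thesis
    using sq by (simp add: ms_tendsto_def square_integrable_lincomb)
qed

lemma ms_tendsto_const: "square_integrable M Y \<Longrightarrow> ms_tendsto M (\<lambda>h. Y) Y F"
  by (simp add: ms_tendsto_def)

text \<open>Continuity of the \<open>L\<^sup>2\<close> inner product: it identifies the second moments of a mean-square derivative
  and the variance of a limit of centred Gaussian variables.\<close>

lemma ms_tendsto_expectation_mult:
  assumes "ms_tendsto M X X' F" "ms_tendsto M Y Y' F"
  shows "((\<lambda>h. expectation (\<lambda>\<omega>. X h \<omega> * Y h \<omega>)) \<longlongrightarrow> expectation (\<lambda>\<omega>. X' \<omega> * Y' \<omega>)) F"
proof -
  let ?dX = "\<lambda>h. expectation (\<lambda>\<omega>. (X h \<omega> - X' \<omega>)\<^sup>2)"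
  let ?dY = "\<lambda>h. expectation (\<lambda>\<omega>. (Y h \<omega> - Y' \<omega>)\<^sup>2)"
  let ?B = "\<lambda>h. sqrt (?dX h) * sqrt (?dY h) + sqrt (?dX h) * sqrt (expectation (\<lambda>\<omega>. (Y' \<omega>)\<^sup>2))
      + sqrt (expectation (\<lambda>\<omega>. (X' \<omega>)\<^sup>2)) * sqrt (?dY h)"
  have sq: "square_integrable M X'" "square_integrable M Y'"
    and ev: "\<forall>\<^sub>F h in F. square_integrable M (X h) \<and> square_integrable M (Y h)"
    and lim: "(?dX \<longlongrightarrow> 0) F" "(?dY \<longlongrightarrow> 0) F"
    using assms by (auto simp: ms_tendsto_def eventually_conj_iff)
  have CS: "\<bar>expectation (\<lambda>\<omega>. U \<omega> * V \<omega>)\<bar> \<le>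
      sqrt (expectation (\<lambda>\<omega>. (U \<omega>)\<^sup>2)) * sqrt (expectation (\<lambda>\<omega>. (V \<omega>)\<^sup>2))"
    if "square_integrable M U" "square_integrable M V" for U V
    using integral_abs_bound[of M "\<lambda>\<omega>. U \<omega> * V \<omega>"] expectation_Cauchy_Schwarz[OF that] by linarith
  have B: "(?B \<longlongrightarrow> sqrt 0 * sqrt 0 + sqrt 0 * sqrt (expectation (\<lambda>\<omega>. (Y' \<omega>)\<^sup>2))
      + sqrt (expectation (\<lambda>\<omega>. (X' \<omega>)\<^sup>2)) * sqrt 0) F"
    by (intro tendsto_intros lim)
  have "((\<lambda>h. expectation (\<lambda>\<omega>. X h \<omega> * Y h \<omega>) - expectation (\<lambda>\<omega>. X' \<omega> * Y' \<omega>)) \<longlongrightarrow> 0) F"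
  proof (rule Lim_null_comparison)
    show "\<forall>\<^sub>F h in F. norm (expectation (\<lambda>\<omega>. X h \<omega> * Y h \<omega>) - expectation (\<lambda>\<omega>. X' \<omega> * Y' \<omega>)) \<le> ?B h"
      using ev
    proof eventually_elim
      case (elim h)
      let ?U = "\<lambda>\<omega>. X h \<omega> - X' \<omega>" and ?V = "\<lambda>\<omega>. Y h \<omega> - Y' \<omega>"
      have UV: "square_integrable M ?U" "square_integrable M ?V"
        using elim sq by (auto intro: square_integrable_diff)
      have "expectation (\<lambda>\<omega>. X h \<omega> * Y h \<omega>) =
          expectation (\<lambda>\<omega>. ?U \<omega> * ?V \<omega> + ?U \<omega> * Y' \<omega> + X' \<omega> * ?V \<omega> + X' \<omega> * Y' \<omega>)"
        by (simp add: algebra_simps)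
      also have "\<dots> = expectation (\<lambda>\<omega>. ?U \<omega> * ?V \<omega>) + expectation (\<lambda>\<omega>. ?U \<omega> * Y' \<omega>)
          + expectation (\<lambda>\<omega>. X' \<omega> * ?V \<omega>) + expectation (\<lambda>\<omega>. X' \<omega> * Y' \<omega>)"
        using UV sq
        by (subst Bochner_Integration.integral_add
            | intro Bochner_Integration.integrable_add square_integrable_mult_integrable | simp)+
      finally show ?case
        using CS[OF UV] CS[OF UV(1) sq(2)] CS[OF sq(1) UV(2)] by simp
    qed
  qed (use B in simp)
  then show ?thesis
    by (simp add: LIM_zero_iff)
qed

text \<open>Completeness of \<open>L\<^sup>2\<close>: since the \<open>L\<^sup>2\<close> norm dominates the \<open>L\<^sup>1\<close> norm, a subsequence
  converges almost surely, and Fatou's lemma transfers the Cauchy bounds to its limit.\<close>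

lemma ms_Cauchy_convergent:
  fixes X :: "nat \<Rightarrow> 'a \<Rightarrow> real"
  assumes sq: "\<And>n. square_integrable M (X n)"
    and Cauchy: "\<And>e. e > 0 \<Longrightarrow> \<exists>N. \<forall>m\<ge>N. \<forall>n\<ge>N. expectation (\<lambda>\<omega>. (X m \<omega> - X n \<omega>)\<^sup>2) < e"
  obtains Y where "ms_tendsto M X Y sequentially"
proof -
  have meas[measurable]: "X n \<in> borel_measurable M" for n
    using sq by (simp add: square_integrable_def)
  have L1: "\<exists>N. \<forall>m\<ge>N. \<forall>n\<ge>N. expectation (\<lambda>\<omega>. norm (X m \<omega> - X n \<omega>)) < e" if "e > 0" for e
  proof -
    obtain N where N: "\<And>m n. m \<ge> N \<Longrightarrow> n \<ge> N \<Longrightarrow> expectation (\<lambda>\<omega>. (X m \<omega> - X n \<omega>)\<^sup>2) < e\<^sup>2"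
      using Cauchy[OF zero_less_power[OF \<open>e > 0\<close>]] by blast
    have "expectation (\<lambda>\<omega>. norm (X m \<omega> - X n \<omega>)) < e" if "m \<ge> N" "n \<ge> N" for m n
    proof -
      have "expectation (\<lambda>\<omega>. norm (X m \<omega> - X n \<omega>)) \<le> sqrt (expectation (\<lambda>\<omega>. (X m \<omega> - X n \<omega>)\<^sup>2))"
        using expectation_Cauchy_Schwarz[OF square_integrable_diff[OF sq sq] square_integrable_const[of 1], of m n]
        by (simp add: prob_space)
      also have "\<dots> < sqrt (e\<^sup>2)"
        using N[OF that] by (rule real_sqrt_less_mono)
      finally show ?thesis using \<open>e > 0\<close> by simp
    qed
    then show ?thesis by blast
  qed
  \<comment> \<open>The almost sure limit along a subsequence serves as the mean-square limit of the whole sequence.\<close>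
  obtain r where r: "strict_mono r" and AE_Cauchy: "AE \<omega> in M. Cauchy (\<lambda>i. X (r i) \<omega>)"
    using cauchy_L1_AE_cauchy_subseq[of M X] sq L1 square_integrable_integrable by blast
  define Y where "Y \<omega> = lim (\<lambda>i. X (r i) \<omega>)" for \<omega>
  have [measurable]: "Y \<in> borel_measurable M"
    unfolding Y_def by (rule borel_measurable_lim_metric) simp
  have AE_lim: "AE \<omega> in M. (\<lambda>i. X (r i) \<omega>) \<longlonglongrightarrow> Y \<omega>"
    using AE_Cauchy by eventually_elim (simp add: Y_def Cauchy_convergent convergent_LIMSEQ_iff[symmetric])
  have Fatou: "(\<integral>\<^sup>+\<omega>. ennreal ((X n \<omega> - Y \<omega>)\<^sup>2) \<partial>M) \<le> ennreal e"
    if N: "\<forall>m\<ge>N. \<forall>n\<ge>N. expectation (\<lambda>\<omega>. (X m \<omega> - X n \<omega>)\<^sup>2) < e" and n: "n \<ge> N" for e N n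
  proof -
    have "(\<integral>\<^sup>+\<omega>. ennreal ((X n \<omega> - Y \<omega>)\<^sup>2) \<partial>M) =
        (\<integral>\<^sup>+\<omega>. liminf (\<lambda>i. ennreal ((X n \<omega> - X (r i) \<omega>)\<^sup>2)) \<partial>M)"
    proof (rule nn_integral_cong_AE)
      show "AE \<omega> in M. ennreal ((X n \<omega> - Y \<omega>)\<^sup>2) = liminf (\<lambda>i. ennreal ((X n \<omega> - X (r i) \<omega>)\<^sup>2))"
        using AE_lim
      proof eventually_elim
        case (elim \<omega>)
        then have "(\<lambda>i. ennreal ((X n \<omega> - X (r i) \<omega>)\<^sup>2)) \<longlonglongrightarrow> ennreal ((X n \<omega> - Y \<omega>)\<^sup>2)"
          by (intro tendsto_intros)
        from lim_imp_Liminf[OF _ this] show ?case by simp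
      qed
    qed
    also have "\<dots> \<le> liminf (\<lambda>i. \<integral>\<^sup>+\<omega>. ennreal ((X n \<omega> - X (r i) \<omega>)\<^sup>2) \<partial>M)"
      by (rule nn_integral_liminf) simp
    also have "\<dots> \<le> liminf (\<lambda>i. ennreal e)"
    proof (rule Liminf_mono)
      show "\<forall>\<^sub>F i in sequentially. (\<integral>\<^sup>+\<omega>. ennreal ((X n \<omega> - X (r i) \<omega>)\<^sup>2) \<partial>M) \<le> ennreal e"
        using eventually_ge_at_top[of N]
      proof eventually_elim
        case (elim i)
        then have "r i \<ge> N" using seq_suble[OF r, of i] by simp
        then show ?case
          using N n sq
          by (simp add: nn_integral_eq_integral square_integrable_diff_square ennreal_leI less_imp_le)
      qed
    qed
    also have "\<dots> = ennreal e" by (simp add: Liminf_const)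
    finally show ?thesis .
  qed
  have finite_dist: "square_integrable M (\<lambda>\<omega>. X n \<omega> - Y \<omega>)"
    if "(\<integral>\<^sup>+\<omega>. ennreal ((X n \<omega> - Y \<omega>)\<^sup>2) \<partial>M) \<le> ennreal e" for n e
    using that unfolding square_integrable_def
    by (auto intro!: integrableI_bounded simp: le_less_trans[OF _ ennreal_less_top])
  obtain N1 where N1: "\<forall>m\<ge>N1. \<forall>n\<ge>N1. expectation (\<lambda>\<omega>. (X m \<omega> - X n \<omega>)\<^sup>2) < 1"
    using Cauchy[of 1] by auto
  have "square_integrable M (\<lambda>\<omega>. X N1 \<omega> - Y \<omega>)"
    by (rule finite_dist[OF Fatou[OF N1 order_refl]])
  from square_integrable_diff[OF sq[of N1] this] have "square_integrable M Y"
    by simp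
  moreover have "(\<lambda>n. expectation (\<lambda>\<omega>. (X n \<omega> - Y \<omega>)\<^sup>2)) \<longlonglongrightarrow> 0"
  proof (rule LIMSEQ_I)
    fix e :: real assume "e > 0"
    then obtain N where N: "\<forall>m\<ge>N. \<forall>n\<ge>N. expectation (\<lambda>\<omega>. (X m \<omega> - X n \<omega>)\<^sup>2) < e / 2"
      using Cauchy[of "e / 2"] by auto
    have "expectation (\<lambda>\<omega>. (X n \<omega> - Y \<omega>)\<^sup>2) \<le> e / 2" if "n \<ge> N" for n
      using Fatou[OF N that] \<open>square_integrable M Y\<close> sq \<open>e > 0\<close>
      by (simp add: nn_integral_eq_integral square_integrable_diff_square)
    then show "\<exists>N. \<forall>n\<ge>N. norm (expectation (\<lambda>\<omega>. (X n \<omega> - Y \<omega>)\<^sup>2) - 0) < e"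
      using \<open>e > 0\<close> by (intro exI[of _ N] allI impI) (simp add: integral_nonneg_AE le_less_trans[of _ "e / 2"])
  qed
  ultimately show thesis
    using sq by (intro that[of Y]) (simp add: ms_tendsto_def)
qed

text \<open>Loeve's criterion: expanding the square, \<open>E (X\<^sub>h - X\<^sub>k)\<^sup>2\<close> tends to \<open>c - 2 c + c = 0\<close>.\<close>

lemma ms_convergent_if_second_moments_converge:
  assumes sq: "\<And>h. square_integrable M (X h)"
    and lim: "((\<lambda>(h, k). expectation (\<lambda>\<omega>. X h \<omega> * X k \<omega>)) \<longlongrightarrow> c) (F \<times>\<^sub>F F)"
    and s: "filterlim s F sequentially"
  obtains Y where "ms_tendsto M X Y F"
proof -
  have close: "\<exists>P. eventually P F \<and> (\<forall>h k. P h \<longrightarrow> P k \<longrightarrow> expectation (\<lambda>\<omega>. (X h \<omega> - X k \<omega>)\<^sup>2) < e)"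
    if "e > 0" for e
  proof -
    have "\<forall>\<^sub>F p in F \<times>\<^sub>F F. dist (case p of (h, k) \<Rightarrow> expectation (\<lambda>\<omega>. X h \<omega> * X k \<omega>)) c < e / 4"
      using tendstoD[OF lim, of "e / 4"] \<open>e > 0\<close> by simp
    then obtain P where P: "eventually P F"
      "\<And>h k. P h \<Longrightarrow> P k \<Longrightarrow> \<bar>expectation (\<lambda>\<omega>. X h \<omega> * X k \<omega>) - c\<bar> < e / 4"
      unfolding eventually_prod_same by (auto simp: dist_real_def)
    have "expectation (\<lambda>\<omega>. (X h \<omega> - X k \<omega>)\<^sup>2) < e" if "P h" "P k" for h k
      using P(2)[of h h] P(2)[of h k] P(2)[of k k] that
      unfolding expectation_diff_square[OF sq sq] by linarith
    with P(1) show ?thesis by blast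
  qed
  \<comment> \<open>Completeness is about sequences, so the limit is found along \<open>s\<close>; closeness of all \<open>X h\<close> for
    late \<open>h\<close> then makes it the limit along \<open>F\<close>.\<close>
  have "\<exists>N. \<forall>m\<ge>N. \<forall>n\<ge>N. expectation (\<lambda>\<omega>. (X (s m) \<omega> - X (s n) \<omega>)\<^sup>2) < e" if "e > 0" for e
  proof -
    obtain P where P: "eventually P F" "\<And>h k. P h \<Longrightarrow> P k \<Longrightarrow> expectation (\<lambda>\<omega>. (X h \<omega> - X k \<omega>)\<^sup>2) < e"
      using close[OF \<open>e > 0\<close>] by blast
    from s P(1) have "\<forall>\<^sub>F n in sequentially. P (s n)" by (simp add: filterlim_iff)
    with P(2) show ?thesis unfolding eventually_sequentially by meson
  qed
  then obtain Y where Y: "ms_tendsto M (\<lambda>n. X (s n)) Y sequentially"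
    using ms_Cauchy_convergent[of "\<lambda>n. X (s n)"] sq by blast
  then have Ysq: "square_integrable M Y"
    and Ylim: "(\<lambda>n. expectation (\<lambda>\<omega>. (X (s n) \<omega> - Y \<omega>)\<^sup>2)) \<longlonglongrightarrow> 0"
    by (auto simp: ms_tendsto_def)
  have "((\<lambda>h. expectation (\<lambda>\<omega>. (X h \<omega> - Y \<omega>)\<^sup>2)) \<longlongrightarrow> 0) F"
  proof (rule tendstoI)
    fix e :: real assume "e > 0"
    obtain P where P: "eventually P F" "\<And>h k. P h \<Longrightarrow> P k \<Longrightarrow> expectation (\<lambda>\<omega>. (X h \<omega> - X k \<omega>)\<^sup>2) < e / 4"
      using close[of "e / 4"] \<open>e > 0\<close> by auto
    from s P(1) have "\<forall>\<^sub>F n in sequentially. P (s n)" by (simp add: filterlim_iff)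
    moreover have "\<forall>\<^sub>F n in sequentially. expectation (\<lambda>\<omega>. (X (s n) \<omega> - Y \<omega>)\<^sup>2) < e / 4"
      using order_tendstoD(2)[OF Ylim, of "e / 4"] \<open>e > 0\<close> by simp
    ultimately have "\<exists>n. P (s n) \<and> expectation (\<lambda>\<omega>. (X (s n) \<omega> - Y \<omega>)\<^sup>2) < e / 4"
      by (intro eventually_happens'[OF sequentially_bot] eventually_conj)
    then obtain n where n: "P (s n)" "expectation (\<lambda>\<omega>. (X (s n) \<omega> - Y \<omega>)\<^sup>2) < e / 4"
      by blast
    show "\<forall>\<^sub>F h in F. dist (expectation (\<lambda>\<omega>. (X h \<omega> - Y \<omega>)\<^sup>2)) 0 < e"
      using P(1)
    proof eventually_elim
      case (elim h)
      have "expectation (\<lambda>\<omega>. (X h \<omega> - Y \<omega>)\<^sup>2) < e"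
        using expectation_diff_square_triangle[OF sq[of h] sq[of "s n"] Ysq] P(2)[OF elim n(1)] n(2)
        by linarith
      then show ?case by (simp add: integral_nonneg_AE)
    qed
  qed
  with Ysq sq show thesis by (intro that[of Y]) (simp add: ms_tendsto_def)
qed

end

section \<open>Mixed derivatives of the covariance and mean-square derivatives of the field\<close>

text \<open>If \<open>k (x, y)\<close> is the second moment \<open>E (f x * f y)\<close> of a field, then the mixed derivative plays the same
  role for the mean-square derivative of \<open>f\<close> in direction \<open>b\<close>, which is why \<open>b\<close> acts once on each
  argument.\<close>

definition mixed_deriv :: "'x::euclidean_space \<Rightarrow> ('x \<times> 'x \<Rightarrow> real) \<Rightarrow> 'x \<times> 'x \<Rightarrow> real" where
  "mixed_deriv b k =
     (\<lambda>p. frechet_derivative (\<lambda>q. frechet_derivative k (at q) (b, 0)) (at p) (0, b))"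

lemma C_class_imp_continuous: "C_class n k \<Longrightarrow> continuous_on UNIV k"
  by (cases n) (auto simp: differentiable_imp_continuous_within continuous_at_imp_continuous_on)

lemma C_class_mixed_deriv: "C_class (Suc (Suc n)) k \<Longrightarrow> C_class n (mixed_deriv b k)"
  unfolding mixed_deriv_def by simp

text \<open>The Frechet derivative at a point of a line, evaluated at the direction, is the ordinary derivative of
  the restriction to the line. This is what reduces the mean value theorem for \<open>k\<close> to one real variable.\<close>

lemma has_real_derivative_along_line:
  fixes k :: "'v::real_normed_vector \<Rightarrow> real"
  assumes "k differentiable at (p + t *\<^sub>R v)"
  shows "((\<lambda>s. k (p + s *\<^sub>R v)) has_real_derivative frechet_derivative k (at (p + t *\<^sub>R v)) v) (at t)"
proof -
  have k: "(k has_derivative frechet_derivative k (at (p + t *\<^sub>R v))) (at (p + t *\<^sub>R v))"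
    using assms by (simp add: frechet_derivative_works)
  have "((\<lambda>s. p + s *\<^sub>R v) has_derivative (\<lambda>s. s *\<^sub>R v)) (at t)"
    by (auto intro!: derivative_eq_intros)
  from has_derivative_compose[OF this k] show ?thesis
    using linear_frechet_derivative[OF assms]
    by (simp add: has_field_derivative_def linear_cmul mult_commute_abs)
qed

lemma mean_value_along_line:
  fixes k :: "'v::real_normed_vector \<Rightarrow> real"
  assumes "\<And>q. k differentiable at q"
  obtains \<xi> where "\<bar>\<xi>\<bar> \<le> \<bar>h\<bar>" "k (p + h *\<^sub>R v) - k p = h * frechet_derivative k (at (p + \<xi> *\<^sub>R v)) v"
proof -
  have "((\<lambda>s. k (p + s *\<^sub>R (h *\<^sub>R v))) has_real_derivative
      frechet_derivative k (at (p + t *\<^sub>R (h *\<^sub>R v))) (h *\<^sub>R v)) (at t)" for t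
    using assms by (rule has_real_derivative_along_line)
  then obtain t where t: "0 < t" "t < 1"
    "k (p + 1 *\<^sub>R (h *\<^sub>R v)) - k (p + 0 *\<^sub>R (h *\<^sub>R v)) =
      (1 - 0) * frechet_derivative k (at (p + t *\<^sub>R (h *\<^sub>R v))) (h *\<^sub>R v)"
    using MVT2[of 0 1 "\<lambda>s. k (p + s *\<^sub>R (h *\<^sub>R v))"
        "\<lambda>t. frechet_derivative k (at (p + t *\<^sub>R (h *\<^sub>R v))) (h *\<^sub>R v)"] by auto
  show thesis
  proof (rule that[of "t * h"])
    show "\<bar>t * h\<bar> \<le> \<bar>h\<bar>"
      using t by (simp add: abs_mult mult_left_le_one_le)
    show "k (p + h *\<^sub>R v) - k p = h * frechet_derivative k (at (p + (t * h) *\<^sub>R v)) v"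
      using t(3) linear_frechet_derivative[OF assms] by (simp add: linear_cmul)
  qed
qed

text \<open>Apply the mean value theorem in the first argument to \<open>\<phi>\<close>, the increment of \<open>k\<close> in its second
  argument; the derivative of \<open>\<phi>\<close> is an increment of \<open>\<partial>\<^sub>b k\<close>, to which it applies once more.\<close>

lemma second_difference_eq_mixed_deriv:
  fixes k :: "'x::euclidean_space \<times> 'x \<Rightarrow> real"
  assumes "C_class (Suc (Suc n)) k"
  obtains \<xi> \<eta> where "\<bar>\<xi>\<bar> \<le> \<bar>s\<bar>" "\<bar>\<eta>\<bar> \<le> \<bar>t\<bar>"
    "k (x + s *\<^sub>R b, y + t *\<^sub>R b) - k (x + s *\<^sub>R b, y) - k (x, y + t *\<^sub>R b) + k (x, y) =
      s * t * mixed_deriv b k (x + \<xi> *\<^sub>R b, y + \<eta> *\<^sub>R b)"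
proof -
  have diff: "k differentiable at q" for q using assms unfolding C_class.simps by blast
  let ?k1 = "\<lambda>q. frechet_derivative k (at q) (b, 0)"
  have diff1: "?k1 differentiable at q" for q using assms unfolding C_class.simps by blast
  define \<phi> where "\<phi> q = k (q + (0, t *\<^sub>R b)) - k q" for q
  have \<phi>_deriv: "(\<phi> has_derivative
      (\<lambda>v. frechet_derivative k (at (q + (0, t *\<^sub>R b))) v - frechet_derivative k (at q) v)) (at q)" for q
  proof -
    have shift: "((\<lambda>q. q + (0, t *\<^sub>R b)) has_derivative (\<lambda>v. v)) (at q)"
      by (auto intro!: derivative_eq_intros)
    have k: "(k has_derivative frechet_derivative k (at r)) (at r)" for r
      using diff by (simp add: frechet_derivative_works)
    show ?thesis
      unfolding \<phi>_def by (rule has_derivative_diff[OF has_derivative_compose[OF shift k] k])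
  qed
  then have "\<phi> differentiable at q" for q
    by (rule differentiableI)
  then obtain \<xi> where \<xi>: "\<bar>\<xi>\<bar> \<le> \<bar>s\<bar>"
    "\<phi> ((x, y) + s *\<^sub>R (b, 0)) - \<phi> (x, y) =
      s * frechet_derivative \<phi> (at ((x, y) + \<xi> *\<^sub>R (b, 0))) (b, 0)"
    by (rule mean_value_along_line)
  obtain \<eta> where \<eta>: "\<bar>\<eta>\<bar> \<le> \<bar>t\<bar>"
    "?k1 ((x + \<xi> *\<^sub>R b, y) + t *\<^sub>R (0, b)) - ?k1 (x + \<xi> *\<^sub>R b, y) =
      t * frechet_derivative ?k1 (at ((x + \<xi> *\<^sub>R b, y) + \<eta> *\<^sub>R (0, b))) (0, b)"
    using diff1 by (rule mean_value_along_line)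
  have "\<phi> ((x, y) + s *\<^sub>R (b, 0)) - \<phi> (x, y) =
      s * (?k1 ((x + \<xi> *\<^sub>R b, y) + t *\<^sub>R (0, b)) - ?k1 (x + \<xi> *\<^sub>R b, y))"
    using \<xi>(2) by (simp add: frechet_derivative_at[OF \<phi>_deriv, symmetric])
  then have "\<phi> (x + s *\<^sub>R b, y) - \<phi> (x, y) =
      s * t * mixed_deriv b k (x + \<xi> *\<^sub>R b, y + \<eta> *\<^sub>R b)"
    using \<eta>(2) by (simp add: mixed_deriv_def)
  then show thesis
    using \<xi>(1) \<eta>(1) by (intro that[of \<xi> \<eta>]) (simp_all add: \<phi>_def)
qed

text \<open>The limit is a joint one in both steps, as Loeve's criterion requires: the intermediate points are
  bounded by the steps, and the mixed derivative is continuous.\<close>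

lemma second_difference_quotient_tendsto:
  fixes k :: "'x::euclidean_space \<times> 'x \<Rightarrow> real"
  assumes "C_class (Suc (Suc n)) k"
  shows "((\<lambda>(s, t). (k (x + s *\<^sub>R b, y + t *\<^sub>R b) - k (x + s *\<^sub>R b, y) - k (x, y + t *\<^sub>R b) + k (x, y)) / (s * t))
    \<longlongrightarrow> mixed_deriv b k (x, y)) (at 0 \<times>\<^sub>F at 0)"
proof (rule tendstoI)
  fix e :: real assume "e > 0"
  let ?g = "\<lambda>p::real \<times> real. mixed_deriv b k (x + fst p *\<^sub>R b, y + snd p *\<^sub>R b)"
  have "continuous_on UNIV (mixed_deriv b k)"
    using C_class_imp_continuous[OF C_class_mixed_deriv[OF assms]] .
  then have "continuous_on UNIV ?g"
    by (rule continuous_on_compose2) (auto intro!: continuous_intros)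
  then have "isCont ?g (0, 0)"
    by (simp add: continuous_on_eq_continuous_at)
  then obtain d where d: "d > 0" "\<And>p. dist p (0, 0) < d \<Longrightarrow> dist (?g p) (?g (0, 0)) < e"
    using \<open>e > 0\<close> unfolding continuous_at_eps_delta by blast
  show "\<forall>\<^sub>F p in at 0 \<times>\<^sub>F at 0. dist (case p of (s, t) \<Rightarrow>
      (k (x + s *\<^sub>R b, y + t *\<^sub>R b) - k (x + s *\<^sub>R b, y) - k (x, y + t *\<^sub>R b) + k (x, y)) / (s * t))
      (mixed_deriv b k (x, y)) < e"
    unfolding eventually_prod_same
  proof (intro exI conjI allI impI)
    show "\<forall>\<^sub>F s in at 0. s \<noteq> 0 \<and> \<bar>s\<bar> < d / 2"
      using eventually_at[of _ "0::real" UNIV] d(1) by (auto simp: dist_real_def intro!: exI[of _ "d/2"])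
    fix s t :: real assume s: "s \<noteq> 0 \<and> \<bar>s\<bar> < d / 2" and t: "t \<noteq> 0 \<and> \<bar>t\<bar> < d / 2"
    obtain \<xi> \<eta> where \<xi>\<eta>: "\<bar>\<xi>\<bar> \<le> \<bar>s\<bar>" "\<bar>\<eta>\<bar> \<le> \<bar>t\<bar>"
      and eq: "k (x + s *\<^sub>R b, y + t *\<^sub>R b) - k (x + s *\<^sub>R b, y) - k (x, y + t *\<^sub>R b) + k (x, y) =
        s * t * mixed_deriv b k (x + \<xi> *\<^sub>R b, y + \<eta> *\<^sub>R b)"
      using second_difference_eq_mixed_deriv[OF assms] by blast
    have "dist (\<xi>, \<eta>) (0, 0) \<le> \<bar>\<xi>\<bar> + \<bar>\<eta>\<bar>"
      by (simp add: dist_Pair_Pair dist_real_def sqrt_sum_squares_le_sum_abs)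
    also have "\<dots> < d" using \<xi>\<eta> s t by linarith
    finally have "dist (?g (\<xi>, \<eta>)) (?g (0, 0)) < e" by (rule d(2))
    then show "dist (case (s, t) of (s, t) \<Rightarrow>
      (k (x + s *\<^sub>R b, y + t *\<^sub>R b) - k (x + s *\<^sub>R b, y) - k (x, y + t *\<^sub>R b) + k (x, y)) / (s * t))
      (mixed_deriv b k (x, y)) < e"
      using s t by (simp add: eq)
  qed
qed

context prob_space
begin

text \<open>The derivative is obtained at all points at once and together with its second moments, so that
  the result applies again to \<open>f'\<close>.\<close>

lemma ms_derivative_exists:
  fixes f :: "'x::euclidean_space \<Rightarrow> 'a \<Rightarrow> real"
  assumes sq: "\<And>x. square_integrable M (f x)"
    and k: "\<And>x y. expectation (\<lambda>\<omega>. f x \<omega> * f y \<omega>) = k (x, y)"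
    and C: "C_class (Suc (Suc n)) k"
  obtains f' where "\<And>x. has_ms_deriv M f b x (f' x)"
    and "\<And>x y. expectation (\<lambda>\<omega>. f' x \<omega> * f' y \<omega>) = mixed_deriv b k (x, y)"
proof -
  define q where "q x h \<omega> = (f (x + h *\<^sub>R b) \<omega> - f x \<omega>) / h" for x h \<omega>
  have q_sq: "square_integrable M (q x h)" for x h
    using square_integrable_lincomb[OF sq[of "x + h *\<^sub>R b"] sq[of x], of "1 / h" "- 1 / h"]
    by (simp add: q_def[abs_def] diff_divide_distrib)
  have q_k: "expectation (\<lambda>\<omega>. q x s \<omega> * q y t \<omega>) =
      (k (x + s *\<^sub>R b, y + t *\<^sub>R b) - k (x + s *\<^sub>R b, y) - k (x, y + t *\<^sub>R b) + k (x, y)) / (s * t)"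
    for x y s t
  proof -
    have "expectation (\<lambda>\<omega>. q x s \<omega> * q y t \<omega>) = expectation (\<lambda>\<omega>.
        (f (x + s *\<^sub>R b) \<omega> * f (y + t *\<^sub>R b) \<omega> - f (x + s *\<^sub>R b) \<omega> * f y \<omega>
          - f x \<omega> * f (y + t *\<^sub>R b) \<omega> + f x \<omega> * f y \<omega>) / (s * t))"
      by (simp add: q_def algebra_simps)
    then show ?thesis
      by (simp add: square_integrable_mult_integrable[OF sq sq] k)
  qed
  have q_lim: "((\<lambda>(s, t). expectation (\<lambda>\<omega>. q x s \<omega> * q y t \<omega>)) \<longlongrightarrow> mixed_deriv b k (x, y)) (at 0 \<times>\<^sub>F at 0)"
    for x y
    unfolding q_k using second_difference_quotient_tendsto[OF C] .
  have "(\<lambda>n. inverse (real (Suc n))) \<longlonglongrightarrow> 0"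
    by (rule LIMSEQ_inverse_real_of_nat)
  then have seq: "filterlim (\<lambda>n. inverse (real (Suc n))) (at 0) sequentially"
    by (simp add: filterlim_at)
  have "\<exists>Y. ms_tendsto M (q x) Y (at 0)" for x
    using ms_convergent_if_second_moments_converge[OF q_sq q_lim seq] by blast
  then obtain f' where f': "\<And>x. ms_tendsto M (q x) (f' x) (at 0)"
    by metis
  have "expectation (\<lambda>\<omega>. f' x \<omega> * f' y \<omega>) = mixed_deriv b k (x, y)" for x y
  proof (rule tendsto_unique)
    show "((\<lambda>h. expectation (\<lambda>\<omega>. q x h \<omega> * q y h \<omega>)) \<longlongrightarrow> expectation (\<lambda>\<omega>. f' x \<omega> * f' y \<omega>)) (at 0)"
      using f' by (rule ms_tendsto_expectation_mult) (rule f')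
    \<comment> \<open>Restrict the joint limit to the diagonal.\<close>
    have "filterlim (\<lambda>h::real. (h, h)) (at 0 \<times>\<^sub>F at 0) (at 0)"
      by (intro filterlim_Pair filterlim_ident)
    from filterlim_compose[OF q_lim this]
    show "((\<lambda>h. expectation (\<lambda>\<omega>. q x h \<omega> * q y h \<omega>)) \<longlongrightarrow> mixed_deriv b k (x, y)) (at 0)"
      by simp
  qed simp
  moreover have "has_ms_deriv M f b x (f' x)" for x
    using f' by (simp add: has_ms_deriv_def q_def[abs_def])
  ultimately show thesis by (rule that[rotated])
qed

lemma taylor_coeffs_exist:
  fixes f :: "(real^'n::finite) \<times> (real^'n) \<Rightarrow> 'a \<Rightarrow> real"
  assumes sq: "\<And>x. square_integrable M (f x)"
    and k: "\<And>x y. expectation (\<lambda>\<omega>. f x \<omega> * f y \<omega>) = k (x, y)"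
    and C: "C_class 4 k"
  shows "\<exists>g H11 H12. taylor_coeffs M f zs g H11 H12"
proof -
  have four: "(4::nat) = Suc (Suc (Suc (Suc 0)))" by simp
  have C': "C_class (Suc (Suc (Suc (Suc 0)))) k" using C unfolding four .
  have first: "\<exists>Y. has_ms_deriv M f b x Y" for b x
    by (rule ms_derivative_exists[OF sq k C', of b]) blast
  have second: "\<exists>Y. has_ms_deriv2 M f a b x Y" for a b x
  proof -
    obtain f' where f': "\<And>x. has_ms_deriv M f b x (f' x)"
      and k': "\<And>x y. expectation (\<lambda>\<omega>. f' x \<omega> * f' y \<omega>) = mixed_deriv b k (x, y)"
      by (rule ms_derivative_exists[OF sq k C', of b]) (rule that)
    from f' have f'_sq: "square_integrable M (f' x)" for x
      by (simp add: has_ms_deriv_def ms_tendsto_def)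
    obtain f'' where "\<And>x. has_ms_deriv M f' a x (f'' x)"
      by (rule ms_derivative_exists[OF f'_sq k' C_class_mixed_deriv[OF C'], of a]) (rule that)
    with f' have "has_ms_deriv2 M f a b x (f'' x)"
      unfolding has_ms_deriv2_def by (intro exI[of _ f'] conjI always_eventually allI)
    then show ?thesis by (intro exI[of _ "f'' x"])
  qed
  have "\<forall>i. \<exists>Y. has_ms_deriv M f (dir1 i) (zs, zs) Y"
    by (intro allI first)
  from choice[OF this] obtain G where G: "\<And>i. has_ms_deriv M f (dir1 i) (zs, zs) (G i)"
    by blast
  have "\<forall>i. \<exists>Y. \<forall>j. has_ms_deriv2 M f (dir1 i) (dir1 j) (zs, zs) (Y j)"
    by (intro allI choice second)
  from choice[OF this] obtain A where A: "\<And>i j. has_ms_deriv2 M f (dir1 i) (dir1 j) (zs, zs) (A i j)"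
    by blast
  have "\<forall>i. \<exists>Y. \<forall>j. has_ms_deriv2 M f (dir1 i) (dir2 j) (zs, zs) (Y j)"
    by (intro allI choice second)
  from choice[OF this] obtain B where B: "\<And>i j. has_ms_deriv2 M f (dir1 i) (dir2 j) (zs, zs) (B i j)"
    by blast
  have "taylor_coeffs M f zs (\<lambda>\<omega>. \<chi> i. G i \<omega>) (\<lambda>\<omega>. \<chi> i j. A i j \<omega>) (\<lambda>\<omega>. \<chi> i j. B i j \<omega>)"
    using G A B by (simp add: taylor_coeffs_def)
  then show ?thesis by blast
qed

end

section \<open>Mean-square limits of centred Gaussian variables\<close>

context prob_space
begin

text \<open>This form treats the degenerate and the non-degenerate case by one formula, so that
  limits need no case distinction on whether the variances tend to zero. The converse is Levy's uniqueness
  theorem, applied to the standardised variable when the variance is positive.\<close>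

lemma centred_gaussian_iff_char:
  assumes sq: "square_integrable M X"
  shows "gaussian_rv M X \<and> expectation X = 0 \<longleftrightarrow>
    (\<forall>t. (CLINT \<omega>|M. iexp (t * X \<omega>)) = complex_of_real (exp (- t\<^sup>2 * expectation (\<lambda>\<omega>. (X \<omega>)\<^sup>2) / 2)))"
    (is "?L \<longleftrightarrow> ?R")
proof
  have [measurable]: "X \<in> borel_measurable M"
    using sq by (simp add: square_integrable_def)
  have char_std: "(CLINT \<omega>|M. iexp (t * Z \<omega>)) = char (distr M borel Z) t"
    if [measurable]: "Z \<in> borel_measurable M" for Z t
    unfolding char_def by (subst integral_distr) auto
  have distr_lborel: "distr M lborel Z = distr M borel Z" for Z :: "'a \<Rightarrow> real"
    by (rule distr_cong) auto
  {
    assume L: ?L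
    then consider \<mu> \<sigma> where "\<sigma> > 0" "distributed M lborel X (normal_density \<mu> \<sigma>)"
      | \<mu> where "AE \<omega> in M. X \<omega> = \<mu>"
      by (auto simp: gaussian_rv_def)
    then show ?R
    proof cases
      case 1
      then have \<mu>: "\<mu> = 0"
        using normal_distributed_expectation[OF 1] L by simp
      then have var: "expectation (\<lambda>\<omega>. (X \<omega>)\<^sup>2) = \<sigma>\<^sup>2"
        using normal_distributed_variance[OF 1] L by simp
      let ?Z = "\<lambda>\<omega>. X \<omega> / \<sigma>"
      have "distr M borel ?Z = std_normal_distribution"
        using normal_standard_normal_convert[OF 1(1), of X \<mu>] 1(2) \<mu>
        by (simp add: distributed_def flip: distr_lborel)
      then have "(CLINT \<omega>|M. iexp (s * ?Z \<omega>)) = complex_of_real (exp (- (s^2) / 2))" for s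
        using char_std[of ?Z s] by (simp add: char_std_normal_distribution)
      from this[of "t * \<sigma>" for t] show ?R
        using \<open>\<sigma> > 0\<close> by (simp add: var power_mult_distrib)
    next
      case 2
      have "expectation X = \<mu>"
        using integral_cong_AE[of X M "\<lambda>_. \<mu>"] 2 by (simp add: prob_space)
      with 2 L have X0: "AE \<omega> in M. X \<omega> = 0" by simp
      have "(CLINT \<omega>|M. iexp (t * X \<omega>)) = (CLINT \<omega>|M. 1)" for t
        using X0 by (intro integral_cong_AE) auto
      moreover have "expectation (\<lambda>\<omega>. (X \<omega>)\<^sup>2) = 0"
        using X0 by (intro integral_eq_zero_AE) auto
      ultimately show ?R by (simp add: prob_space)
    qed
  next
    assume R: ?R
    show ?L
    proof (cases "expectation (\<lambda>\<omega>. (X \<omega>)\<^sup>2) = 0")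
      case True
      then have X0: "AE \<omega> in M. X \<omega> = 0"
        using sq integral_nonneg_eq_0_iff_AE[of M "\<lambda>\<omega>. (X \<omega>)\<^sup>2"] by (simp add: square_integrable_def)
      then have "expectation X = 0"
        by (rule integral_eq_zero_AE)
      with X0 show ?L by (auto simp: gaussian_rv_def)
    next
      case False
      define \<sigma> where "\<sigma> = sqrt (expectation (\<lambda>\<omega>. (X \<omega>)\<^sup>2))"
      have "expectation (\<lambda>\<omega>. (X \<omega>)\<^sup>2) \<ge> 0" by (simp add: integral_nonneg_AE)
      with False have "expectation (\<lambda>\<omega>. (X \<omega>)\<^sup>2) > 0" by linarith
      then have \<sigma>: "\<sigma> > 0" "\<sigma>\<^sup>2 = expectation (\<lambda>\<omega>. (X \<omega>)\<^sup>2)"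
        by (auto simp: \<sigma>_def)
      let ?Z = "\<lambda>\<omega>. X \<omega> / \<sigma>"
      have "char (distr M borel ?Z) t = char std_normal_distribution t" for t
      proof -
        have "char (distr M borel ?Z) t = (CLINT \<omega>|M. iexp ((t / \<sigma>) * X \<omega>))"
          by (simp add: char_std[symmetric])
        also have "\<dots> = complex_of_real (exp (- (t / \<sigma>)\<^sup>2 * \<sigma>\<^sup>2 / 2))"
          using R unfolding \<sigma>(2) by blast
        also have "\<dots> = char std_normal_distribution t"
          using \<sigma>(1) by (simp add: char_std_normal_distribution power_divide)
        finally show ?thesis .
      qed
      then have "distr M borel ?Z = std_normal_distribution"
        by (intro Levy_uniqueness real_dist_normal_dist real_distribution_distr ext) auto
      then have "distributed M lborel X (normal_density 0 \<sigma>)"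
        using normal_standard_normal_convert[OF \<sigma>(1), of X 0]
        by (simp add: distributed_def distr_lborel)
      with \<sigma>(1) show ?L
        using normal_distributed_expectation[of \<sigma> X 0] by (auto simp: gaussian_rv_def)
    qed
  }
qed

lemma cmod_iexp_diff_le: "cmod (iexp x - iexp y) \<le> \<bar>x - y\<bar>"
proof -
  have "iexp x - iexp y = iexp y * (iexp (x - y) - 1)"
    by (simp add: algebra_simps flip: exp_add)
  then show ?thesis
    using iexp_approx1[of "x - y" 0] by (simp add: norm_mult)
qed

text \<open>\<open>x \<mapsto> exp (i t x)\<close> has Lipschitz constant \<open>\<bar>t\<bar>\<close>, so characteristic functions differ by at most \<open>\<bar>t\<bar>\<close>
  times the \<open>L\<^sup>1\<close> distance, hence by at most \<open>\<bar>t\<bar>\<close> times the \<open>L\<^sup>2\<close> distance.\<close>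

lemma ms_tendsto_char:
  assumes "ms_tendsto M X Y F"
  shows "((\<lambda>h. CLINT \<omega>|M. iexp (t * X h \<omega>)) \<longlongrightarrow> (CLINT \<omega>|M. iexp (t * Y \<omega>))) F"
proof -
  let ?d = "\<lambda>h. expectation (\<lambda>\<omega>. (X h \<omega> - Y \<omega>)\<^sup>2)"
  have Y: "square_integrable M Y" and ev: "\<forall>\<^sub>F h in F. square_integrable M (X h)"
    and lim: "(?d \<longlongrightarrow> 0) F"
    using assms by (auto simp: ms_tendsto_def)
  have bound: "((\<lambda>h. \<bar>t\<bar> * sqrt (?d h)) \<longlongrightarrow> \<bar>t\<bar> * sqrt 0) F"
    by (intro tendsto_intros lim)
  have "((\<lambda>h. (CLINT \<omega>|M. iexp (t * X h \<omega>)) - (CLINT \<omega>|M. iexp (t * Y \<omega>))) \<longlongrightarrow> 0) F"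
  proof (rule Lim_null_comparison)
    show "\<forall>\<^sub>F h in F. cmod ((CLINT \<omega>|M. iexp (t * X h \<omega>)) - (CLINT \<omega>|M. iexp (t * Y \<omega>)))
        \<le> \<bar>t\<bar> * sqrt (?d h)"
      using ev
    proof eventually_elim
      case (elim h)
      have [measurable]: "X h \<in> borel_measurable M" "Y \<in> borel_measurable M"
        using elim Y by (auto simp: square_integrable_def)
      note sq = square_integrable_diff[OF elim Y]
      have int: "integrable M (\<lambda>\<omega>. iexp (t * X h \<omega>))" "integrable M (\<lambda>\<omega>. iexp (t * Y \<omega>))"
        by (auto intro!: integrable_iexp)
      have "cmod ((CLINT \<omega>|M. iexp (t * X h \<omega>)) - (CLINT \<omega>|M. iexp (t * Y \<omega>))) =
          cmod (CLINT \<omega>|M. iexp (t * X h \<omega>) - iexp (t * Y \<omega>))"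
        using int by simp
      also have "\<dots> \<le> expectation (\<lambda>\<omega>. cmod (iexp (t * X h \<omega>) - iexp (t * Y \<omega>)))"
        by (rule integral_norm_bound)
      also have "\<dots> \<le> expectation (\<lambda>\<omega>. \<bar>t\<bar> * \<bar>X h \<omega> - Y \<omega>\<bar>)"
      proof (rule integral_mono)
        show "integrable M (\<lambda>\<omega>. \<bar>t\<bar> * \<bar>X h \<omega> - Y \<omega>\<bar>)"
          using square_integrable_integrable[OF sq] by simp
        show "cmod (iexp (t * X h \<omega>) - iexp (t * Y \<omega>)) \<le> \<bar>t\<bar> * \<bar>X h \<omega> - Y \<omega>\<bar>" for \<omega>
          using cmod_iexp_diff_le[of "t * X h \<omega>" "t * Y \<omega>"]
          by (simp flip: abs_mult right_diff_distrib)
      qed (use int in auto)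
      also have "\<dots> \<le> \<bar>t\<bar> * sqrt (?d h)"
        using expectation_Cauchy_Schwarz[OF sq square_integrable_const[of 1]]
        by (simp add: prob_space mult_left_mono)
      finally show ?case .
    qed
  qed (use bound in simp)
  then show ?thesis by (simp add: LIM_zero_iff)
qed

lemma ms_limit_centred_gaussian:
  assumes lim: "ms_tendsto M X Y F" and F: "F \<noteq> bot"
    and X: "\<forall>\<^sub>F h in F. gaussian_rv M (X h) \<and> expectation (X h) = 0"
  shows "gaussian_rv M Y \<and> expectation Y = 0"
proof -
  have Y: "square_integrable M Y" and ev: "\<forall>\<^sub>F h in F. square_integrable M (X h)"
    using lim by (auto simp: ms_tendsto_def)
  have "(CLINT \<omega>|M. iexp (t * Y \<omega>)) = complex_of_real (exp (- t\<^sup>2 * expectation (\<lambda>\<omega>. (Y \<omega>)\<^sup>2) / 2))" for t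
  proof (rule tendsto_unique[OF F])
    show "((\<lambda>h. CLINT \<omega>|M. iexp (t * X h \<omega>)) \<longlongrightarrow> (CLINT \<omega>|M. iexp (t * Y \<omega>))) F"
      using lim by (rule ms_tendsto_char)
    have "((\<lambda>h. expectation (\<lambda>\<omega>. (X h \<omega>)\<^sup>2)) \<longlongrightarrow> expectation (\<lambda>\<omega>. (Y \<omega>)\<^sup>2)) F"
      using ms_tendsto_expectation_mult[OF lim lim] by (simp add: power2_eq_square)
    then have "((\<lambda>h. complex_of_real (exp (- t\<^sup>2 * expectation (\<lambda>\<omega>. (X h \<omega>)\<^sup>2) / 2))) \<longlongrightarrow>
        complex_of_real (exp (- t\<^sup>2 * expectation (\<lambda>\<omega>. (Y \<omega>)\<^sup>2) / 2))) F"
      by (intro tendsto_intros) auto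
    moreover have "\<forall>\<^sub>F h in F. complex_of_real (exp (- t\<^sup>2 * expectation (\<lambda>\<omega>. (X h \<omega>)\<^sup>2) / 2)) =
        (CLINT \<omega>|M. iexp (t * X h \<omega>))"
      using ev X
    proof eventually_elim
      case (elim h)
      then show ?case using centred_gaussian_iff_char[OF elim(1)] by simp
    qed
    ultimately show "((\<lambda>h. CLINT \<omega>|M. iexp (t * X h \<omega>)) \<longlongrightarrow>
        complex_of_real (exp (- t\<^sup>2 * expectation (\<lambda>\<omega>. (Y \<omega>)\<^sup>2) / 2))) F"
      by (rule Lim_transform_eventually)
  qed
  then show ?thesis using centred_gaussian_iff_char[OF Y] by blast
qed

end

section \<open>The closed linear span of a random field\<close>

definition finite_lincombs :: "('x \<Rightarrow> 'w \<Rightarrow> real) \<Rightarrow> ('w \<Rightarrow> real) set" where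
  "finite_lincombs f = {\<lambda>\<omega>. \<Sum>x\<in>S. c x * f x \<omega> | S c. finite S}"

text \<open>All versions of a limit belong to the span, since only mean-square distances to it enter. This
  matters because mean-square derivatives are determined only up to almost sure equality.\<close>

definition ms_span :: "'w measure \<Rightarrow> ('x \<Rightarrow> 'w \<Rightarrow> real) \<Rightarrow> ('w \<Rightarrow> real) set" where
  "ms_span M f = {Y. \<exists>L. (\<forall>n. L n \<in> finite_lincombs f) \<and> ms_tendsto M L Y sequentially}"

lemma finite_lincombsI: "finite S \<Longrightarrow> (\<lambda>\<omega>. \<Sum>x\<in>S. c x * f x \<omega>) \<in> finite_lincombs f"
  unfolding finite_lincombs_def mem_Collect_eq by (intro exI[of _ S] exI[of _ c]) simp

lemma finite_lincombs_lincomb: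
  assumes "X \<in> finite_lincombs f" "Y \<in> finite_lincombs f"
  shows "(\<lambda>\<omega>. a * X \<omega> + b * Y \<omega>) \<in> finite_lincombs f"
proof -
  obtain S c where S: "finite S" "X = (\<lambda>\<omega>. \<Sum>x\<in>S. c x * f x \<omega>)"
    using assms(1) by (auto simp: finite_lincombs_def)
  obtain T d where T: "finite T" "Y = (\<lambda>\<omega>. \<Sum>x\<in>T. d x * f x \<omega>)"
    using assms(2) by (auto simp: finite_lincombs_def)
  let ?e = "\<lambda>x. a * (if x \<in> S then c x else 0) + b * (if x \<in> T then d x else 0)"
  have "a * X \<omega> + b * Y \<omega> = (\<Sum>x\<in>S \<union> T. ?e x * f x \<omega>)" for \<omega>
  proof -
    have "X \<omega> = (\<Sum>x\<in>S \<union> T. (if x \<in> S then c x else 0) * f x \<omega>)"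
      unfolding S(2) using S(1) T(1) by (intro sum.mono_neutral_cong_left) auto
    moreover have "Y \<omega> = (\<Sum>x\<in>S \<union> T. (if x \<in> T then d x else 0) * f x \<omega>)"
      unfolding T(2) using S(1) T(1) by (intro sum.mono_neutral_cong_left) auto
    ultimately show ?thesis
      by (simp only: sum_distrib_left distrib_right sum.distrib mult.assoc)
  qed
  then show ?thesis
    using finite_lincombsI[of "S \<union> T" ?e f] S(1) T(1) by simp
qed

lemma ms_span_square_integrable: "Y \<in> ms_span M f \<Longrightarrow> square_integrable M Y"
  by (auto simp: ms_span_def ms_tendsto_def)

context prob_space
begin

lemma ms_span_base:
  assumes "square_integrable M (f x)"
  shows "f x \<in> ms_span M f"
proof -
  have "f x \<in> finite_lincombs f"
    using finite_lincombsI[of "{x}" "\<lambda>_. 1" f] by simp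
  then show ?thesis
    using ms_tendsto_const[OF assms] by (auto simp: ms_span_def intro!: exI[of _ "\<lambda>_. f x"])
qed

lemma ms_span_lincomb:
  assumes "X \<in> ms_span M f" "Y \<in> ms_span M f"
  shows "(\<lambda>\<omega>. a * X \<omega> + b * Y \<omega>) \<in> ms_span M f"
proof -
  obtain K where K: "\<And>n. K n \<in> finite_lincombs f" "ms_tendsto M K X sequentially"
    using assms(1) by (auto simp: ms_span_def)
  obtain L where L: "\<And>n. L n \<in> finite_lincombs f" "ms_tendsto M L Y sequentially"
    using assms(2) by (auto simp: ms_span_def)
  show ?thesis
    unfolding ms_span_def mem_Collect_eq
    by (intro exI[of _ "\<lambda>n \<omega>. a * K n \<omega> + b * L n \<omega>"] conjI allI
        finite_lincombs_lincomb ms_tendsto_lincomb K L)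
qed

lemma ms_span_zero: "(\<lambda>\<omega>. 0) \<in> ms_span M f"
proof -
  have "(\<lambda>\<omega>. 0) \<in> finite_lincombs f"
    using finite_lincombsI[of "{}" _ f] by simp
  then show ?thesis
    using ms_tendsto_const[OF square_integrable_const[of 0]]
    by (auto simp: ms_span_def intro!: exI[of _ "\<lambda>_ _. 0"])
qed

lemma ms_span_scale: "X \<in> ms_span M f \<Longrightarrow> (\<lambda>\<omega>. a * X \<omega>) \<in> ms_span M f"
  using ms_span_lincomb[OF _ ms_span_zero, of X f a 0] by simp

lemma ms_span_add:
  "X \<in> ms_span M f \<Longrightarrow> Y \<in> ms_span M f \<Longrightarrow> (\<lambda>\<omega>. X \<omega> + Y \<omega>) \<in> ms_span M f"
  using ms_span_lincomb[of X f Y 1 1] by simp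

lemma ms_span_diff:
  "X \<in> ms_span M f \<Longrightarrow> Y \<in> ms_span M f \<Longrightarrow> (\<lambda>\<omega>. X \<omega> - Y \<omega>) \<in> ms_span M f"
  using ms_span_lincomb[of X f Y 1 "-1"] by simp

lemma ms_span_sum:
  assumes "finite S" "\<And>x. x \<in> S \<Longrightarrow> X x \<in> ms_span M f"
  shows "(\<lambda>\<omega>. \<Sum>x\<in>S. X x \<omega>) \<in> ms_span M f"
  using assms by (induction S rule: finite_induct) (simp_all add: ms_span_zero ms_span_add)

text \<open>The span is defined by one limit over sequences, but a second derivative is an iterated limit over
  continuous steps; a diagonal choice of approximating combinations brings this back to one sequence.\<close>

lemma ms_span_closed:
  assumes lim: "ms_tendsto M X Y F" and F: "F \<noteq> bot"
    and X: "\<forall>\<^sub>F h in F. X h \<in> ms_span M f"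
  shows "Y \<in> ms_span M f"
proof -
  have Y: "square_integrable M Y"
    and d: "((\<lambda>h. expectation (\<lambda>\<omega>. (X h \<omega> - Y \<omega>)\<^sup>2)) \<longlongrightarrow> 0) F"
    using lim by (auto simp: ms_tendsto_def)
  have approx: "\<exists>L. L \<in> finite_lincombs f \<and> square_integrable M L \<and> expectation (\<lambda>\<omega>. (L \<omega> - Y \<omega>)\<^sup>2) < e"
    if "e > 0" for e
  proof -
    have "\<exists>h. X h \<in> ms_span M f \<and> expectation (\<lambda>\<omega>. (X h \<omega> - Y \<omega>)\<^sup>2) < e / 4"
      using order_tendstoD(2)[OF d, of "e / 4"] \<open>e > 0\<close> X
      by (intro eventually_happens'[OF F] eventually_conj) auto
    then obtain h where h: "X h \<in> ms_span M f" "expectation (\<lambda>\<omega>. (X h \<omega> - Y \<omega>)\<^sup>2) < e / 4"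
      by blast
    from h(1) obtain L where L: "\<And>n. L n \<in> finite_lincombs f" "ms_tendsto M L (X h) sequentially"
      by (auto simp: ms_span_def)
    from L(2) have "\<forall>\<^sub>F n in sequentially. square_integrable M (L n)"
      and lim_L: "(\<lambda>n. expectation (\<lambda>\<omega>. (L n \<omega> - X h \<omega>)\<^sup>2)) \<longlonglongrightarrow> 0"
      by (auto simp: ms_tendsto_def)
    moreover have "\<forall>\<^sub>F n in sequentially. expectation (\<lambda>\<omega>. (L n \<omega> - X h \<omega>)\<^sup>2) < e / 4"
      using order_tendstoD(2)[OF lim_L, of "e / 4"] \<open>e > 0\<close> by simp
    ultimately have "\<exists>n. square_integrable M (L n) \<and> expectation (\<lambda>\<omega>. (L n \<omega> - X h \<omega>)\<^sup>2) < e / 4"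
      by (intro eventually_happens'[OF sequentially_bot] eventually_conj)
    then obtain n where n: "square_integrable M (L n)" "expectation (\<lambda>\<omega>. (L n \<omega> - X h \<omega>)\<^sup>2) < e / 4"
      by blast
    have "expectation (\<lambda>\<omega>. (L n \<omega> - Y \<omega>)\<^sup>2) < e"
      using expectation_diff_square_triangle[OF n(1) ms_span_square_integrable[OF h(1)] Y] n(2) h(2)
      by linarith
    with L(1) n(1) show ?thesis by blast
  qed
  have "\<exists>L. \<forall>n. L n \<in> finite_lincombs f \<and> square_integrable M (L n) \<and>
      expectation (\<lambda>\<omega>. (L n \<omega> - Y \<omega>)\<^sup>2) < inverse (real (Suc n))"
    by (intro choice allI approx) simp
  then obtain L where L: "\<And>n. L n \<in> finite_lincombs f" "\<And>n. square_integrable M (L n)"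
    "\<And>n. expectation (\<lambda>\<omega>. (L n \<omega> - Y \<omega>)\<^sup>2) < inverse (real (Suc n))"
    by blast
  have "(\<lambda>n. expectation (\<lambda>\<omega>. (L n \<omega> - Y \<omega>)\<^sup>2)) \<longlonglongrightarrow> 0"
  proof (rule Lim_null_comparison[OF _ LIMSEQ_inverse_real_of_nat])
    show "\<forall>\<^sub>F n in sequentially. norm (expectation (\<lambda>\<omega>. (L n \<omega> - Y \<omega>)\<^sup>2)) \<le> inverse (real (Suc n))"
      using L(3) by (intro always_eventually allI) (simp add: integral_nonneg_AE less_imp_le del: of_nat_Suc)
  qed
  with L Y show ?thesis
    unfolding ms_span_def ms_tendsto_def by (intro CollectI exI[of _ L]) simp
qed

lemma ms_span_centred_gaussian:
  assumes f: "gaussian_field M f" "mean_zero M f" and Y: "Y \<in> ms_span M f"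
  shows "gaussian_rv M Y \<and> expectation Y = 0"
proof -
  obtain L where L: "\<And>n. L n \<in> finite_lincombs f" "ms_tendsto M L Y sequentially"
    using Y by (auto simp: ms_span_def)
  have "gaussian_rv M (L n) \<and> expectation (L n) = 0" for n
  proof -
    obtain S c where S: "finite S" "L n = (\<lambda>\<omega>. \<Sum>x\<in>S. c x * f x \<omega>)"
      using L(1)[of n] by (auto simp: finite_lincombs_def)
    have "integrable M (f x)" for x
      using f(1) by (simp add: gaussian_field_def square_integrable_integrable)
    then have "expectation (L n) = 0"
      using f(2) by (simp add: S(2) mean_zero_def)
    moreover have "gaussian_rv M (L n)"
      using f(1) S by (simp add: gaussian_field_def)
    ultimately show ?thesis by simp
  qed
  then show ?thesis
    by (intro ms_limit_centred_gaussian[OF L(2) sequentially_bot]) simp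
qed

text \<open>Joint Gaussianity comes from the span being a linear space: a finite linear combination of the
  \<open>E x\<close> is again one of its elements.\<close>

lemma gaussian_field_in_ms_span:
  assumes f: "gaussian_field M f" "mean_zero M f" and E: "\<And>x. E x \<in> ms_span M f"
  shows "gaussian_field M E \<and> mean_zero M E"
proof -
  have "(\<lambda>\<omega>. \<Sum>x\<in>S. c x * E x \<omega>) \<in> ms_span M f" if "finite S" for S c
    using that E by (intro ms_span_sum ms_span_scale)
  then have "gaussian_rv M (\<lambda>\<omega>. \<Sum>x\<in>S. c x * E x \<omega>)" if "finite S" for S c
    using that ms_span_centred_gaussian[OF f] by blast
  then show ?thesis
    using ms_span_square_integrable[OF E] ms_span_centred_gaussian[OF f E]
    by (simp add: gaussian_field_def mean_zero_def)
qed

section \<open>The Taylor approximation lies in the closed linear span\<close>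

text \<open>Membership is assumed only near \<open>x\<close>, because in an iterated derivative the first derivative is
  known only there.\<close>

lemma ms_deriv_in_ms_span:
  assumes "\<forall>\<^sub>F y in nhds x. f' y \<in> ms_span M f" and "has_ms_deriv M f' b x Y"
  shows "Y \<in> ms_span M f"
proof (rule ms_span_closed)
  show "ms_tendsto M (\<lambda>h \<omega>. (f' (x + h *\<^sub>R b) \<omega> - f' x \<omega>) / h) Y (at 0)"
    using assms(2) by (simp add: has_ms_deriv_def)
  have "((\<lambda>h. x + h *\<^sub>R b) \<longlongrightarrow> x + 0 *\<^sub>R b) (at 0)"
    by (intro tendsto_intros)
  then have "((\<lambda>h. x + h *\<^sub>R b) \<longlongrightarrow> x) (at 0)"
    by simp
  from eventually_compose_filterlim[OF assms(1) this]
  have "\<forall>\<^sub>F h in at 0. f' (x + h *\<^sub>R b) \<in> ms_span M f" .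
  then show "\<forall>\<^sub>F h in at 0. (\<lambda>\<omega>. (f' (x + h *\<^sub>R b) \<omega> - f' x \<omega>) / h) \<in> ms_span M f"
  proof eventually_elim
    case (elim h)
    from ms_span_scale[OF ms_span_diff[OF elim eventually_nhds_x_imp_x[OF assms(1)]], of "1 / h"]
    show ?case by simp
  qed
qed simp

lemma ms_deriv2_in_ms_span:
  assumes "\<And>x. f x \<in> ms_span M f" and "has_ms_deriv2 M f a b x Y"
  shows "Y \<in> ms_span M f"
proof -
  obtain f' where f': "\<forall>\<^sub>F y in nhds x. has_ms_deriv M f b y (f' y)" "has_ms_deriv M f' a x Y"
    using assms(2) by (auto simp: has_ms_deriv2_def)
  from f'(1) have "\<forall>\<^sub>F y in nhds x. f' y \<in> ms_span M f"
    by eventually_elim (rule ms_deriv_in_ms_span[where f' = f], use assms(1) in auto)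
  then show ?thesis using f'(2) by (rule ms_deriv_in_ms_span)
qed

lemma taylor_approx_in_ms_span:
  assumes f: "\<And>x. f x \<in> ms_span M f" and T: "taylor_coeffs M f zs g H11 H12"
  shows "taylor_approx zs g H11 H12 x \<in> ms_span M f"
proof -
  have g: "(\<lambda>\<omega>. g \<omega> $ i) \<in> ms_span M f" for i
    using T f unfolding taylor_coeffs_def
    by (intro ms_deriv_in_ms_span[where f' = f and x = "(zs, zs)" and b = "dir1 i"] always_eventually) auto
  have H11: "(\<lambda>\<omega>. H11 \<omega> $ i $ j) \<in> ms_span M f" for i j
  proof (rule ms_deriv2_in_ms_span)
    show "has_ms_deriv2 M f (dir1 i) (dir1 j) (zs, zs) (\<lambda>\<omega>. H11 \<omega> $ i $ j)"
      using T unfolding taylor_coeffs_def by blast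
  qed (rule f)
  have H12: "(\<lambda>\<omega>. H12 \<omega> $ i $ j) \<in> ms_span M f" for i j
  proof (rule ms_deriv2_in_ms_span)
    show "has_ms_deriv2 M f (dir1 i) (dir2 j) (zs, zs) (\<lambda>\<omega>. H12 \<omega> $ i $ j)"
      using T unfolding taylor_coeffs_def by blast
  qed (rule f)
  have lin: "(\<lambda>\<omega>. g \<omega> \<bullet> u) \<in> ms_span M f" for u
  proof -
    have "(\<lambda>\<omega>. \<Sum>i\<in>UNIV. u $ i * g \<omega> $ i) \<in> ms_span M f"
      using g by (intro ms_span_sum ms_span_scale) auto
    then show ?thesis by (simp add: inner_vec_def mult.commute)
  qed
  have quad: "(\<lambda>\<omega>. u \<bullet> (H \<omega> *v w)) \<in> ms_span M f"
    if "\<And>i j. (\<lambda>\<omega>. H \<omega> $ i $ j) \<in> ms_span M f" for H u w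
  proof -
    have "(\<lambda>\<omega>. \<Sum>i\<in>UNIV. u $ i * (\<Sum>j\<in>UNIV. w $ j * H \<omega> $ i $ j)) \<in> ms_span M f"
      using that by (intro ms_span_sum ms_span_scale) auto
    then show ?thesis by (simp add: inner_vec_def matrix_vector_mult_def mult.commute)
  qed
  show ?thesis
    unfolding taylor_approx_def Let_def split_beta
    by (intro ms_span_add ms_span_diff ms_span_scale lin quad H11 H12)
qed

end

theorem proposition26:
  fixes M :: "'w measure"
    and f :: "(real^'n::finite) \<times> (real^'n) \<Rightarrow> 'w \<Rightarrow> real"
    and zs :: "real^'n"
  assumes "prob_space M"
    and "gaussian_field M f"
    and "mean_zero M f"
    and "skew_symmetric M f"
    and "C_class 4 (covariance_fun M f)"
  shows "(\<exists>g H11 H12. taylor_coeffs M f zs g H11 H12) \<and>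
    (\<forall>g H11 H12. taylor_coeffs M f zs g H11 H12 \<longrightarrow>
       gaussian_field M (\<lambda>x \<omega>. taylor_approx zs g H11 H12 x \<omega> - f x \<omega>) \<and>
       mean_zero M (\<lambda>x \<omega>. taylor_approx zs g H11 H12 x \<omega> - f x \<omega>))"
proof -
  interpret prob_space M by fact
  have sq: "square_integrable M (f x)" for x
    using assms(2) unfolding gaussian_field_def by blast
  have cov: "expectation (\<lambda>\<omega>. f x \<omega> * f y \<omega>) = covariance_fun M f (x, y)" for x y
  proof -
    have "expectation (f x) = 0" for x
      using assms(3) unfolding mean_zero_def by blast
    then show ?thesis by (simp add: covariance_fun_def)
  qed
  have f: "f x \<in> ms_span M f" for x
    using sq by (rule ms_span_base)
  show ?thesis
    using taylor_coeffs_exist[OF sq cov assms(5)]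
    by (auto intro!: gaussian_field_in_ms_span[OF assms(2,3), THEN conjunct1]
        gaussian_field_in_ms_span[OF assms(2,3), THEN conjunct2] ms_span_diff taylor_approx_in_ms_span f)
qed

end
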